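(* Let $\mathtt z$ be a real random variable with law $\zeta$ such that $\mathtt z\in\mathbb L^1$, $\mathbb E[\mathtt z]=0$, $\mathbb E[\mathtt z^2]\in(0,\infty)$, such that for some $n_0\ge1$ the $n_0$-fold convolution $\zeta^{*n_0}$ has a density, and such that $\mathbb E[(\mathtt z^+)^\xi]<\infty$ for some $\xi>4$ (in particular this last condition holds if $\mathbb E[\exp(c\,\mathtt z^+)]<\infty$ for some $c>0$). Let $\nu$ be the invariant Radon measure of the Markov chain $Y$ of the context, normalized so that $\nu((-\infty,x])\sim x$ as $x\to\infty$. Then $$\int_{\mathbb R}\log(1+e^{-x})\,\nu(\mathrm dx)=\frac{\mathbb E[\mathtt z^2]}2 .$$
   Context: $\mathtt z^+=\max(\mathtt z,0)$. $Y$ is the Markov chain $Y_{n+1}=\mathtt z_{n+1}+h(Y_n)$ on $\mathbb R$, with $(\mathtt z_n)$ IID copies of $\mathtt z$ and $h(y)=y+\log(1+e^{-y})$. A measure $\nu$ is invariant if $\int g\,\mathrm d\nu=\iint g(z+h(y))\,\zeta(\mathrm dz)\,\nu(\mathrm dy)$ for all measurable $g\ge0$. Under the assumptions of the claim, every nonzero invariant Radon measure satisfies $\nu((-\infty,x])=c_\nu x+d_\nu+O(x^{-(\xi-3)})$ as $x\to\infty$ with $c_\nu>0$, $d_\nu\in\mathbb R$; the normalization in the claim means $c_\nu=1$. *)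

theory Defs
  imports "HOL-Probability.Probability" "HOL-Library.Landau_Symbols"
begin

definition h :: "real \<Rightarrow> real" where
  "h y = y + ln (1 + exp (- y))"

text \<open>The 0-th power is the Dirac mass at 0, the neutral element of convolution, so that the
  first power of a Borel probability measure is the measure itself.\<close>

primrec conv_power :: "real measure \<Rightarrow> nat \<Rightarrow> real measure" where
  "conv_power \<zeta> 0 = return borel 0"
| "conv_power \<zeta> (Suc n) = convolution \<zeta> (conv_power \<zeta> n)"

definition has_lebesgue_density :: "real measure \<Rightarrow> bool" where
  "has_lebesgue_density \<mu> \<longleftrightarrow> (\<exists>f \<in> borel_measurable lborel. \<mu> = density lborel f)"

text \<open>On the real line a Borel measure that is finite on compact sets is automatically regular,
  so regularity is not required separately.\<close>

definition radon_measure :: "real measure \<Rightarrow> bool" where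
  "radon_measure \<nu> \<longleftrightarrow>
     sets \<nu> = sets borel \<and> (\<forall>K. compact K \<longrightarrow> emeasure \<nu> K < \<infinity>)"

text \<open>Invariance for the Markov chain \<open>Y (n + 1) = z (n + 1) + h (Y n)\<close> whose increments
  \<open>z n\<close> are independent with law \<open>\<zeta>\<close>.\<close>

definition invariant_measure :: "real measure \<Rightarrow> real measure \<Rightarrow> bool" where
  "invariant_measure \<zeta> \<nu> \<longleftrightarrow>
     (\<forall>g :: real \<Rightarrow> ennreal. g \<in> borel_measurable borel \<longrightarrow>
        (\<integral>\<^sup>+y. g y \<partial>\<nu>) = (\<integral>\<^sup>+y. (\<integral>\<^sup>+z. g (z + h y) \<partial>\<zeta>) \<partial>\<nu>))"

end

theory Submission imports Defs begin

text \<open>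
The identity is a flux balance. Each step of the chain first pushes \<open>y\<close> to the right by
\<open>h y - y = ln (1 + exp (- y))\<close> and then adds a centred noise \<open>z\<close>. Tested against a convex decreasing
function, the push lowers its \<open>\<nu>\<close>-integral and the noise raises it (Jensen); by invariance the two
effects cancel exactly (\<open>invariant_ramp_identity\<close>).

The test function is \<open>ramp T\<close>, the average over \<open>x \<in> [0, T]\<close> of the positive part of \<open>x - w\<close>: it vanishes
beyond \<open>T\<close>, has slope \<open>-1\<close> on the negative half-line, and has curvature \<open>1 / T\<close> in between. As \<open>T\<close>
grows, \<open>ramp T y - ramp T (h y)\<close> tends to \<open>h y - y\<close> and is dominated by it, so the effect of the
push tends to the integral on the left of the theorem, by Fatou's lemma, even before that integral
is known to be finite. The effect of a noise value \<open>z\<close> is the integral of the first-order Taylor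
remainder of \<open>ramp T\<close> at the points \<open>h y\<close>. Since \<open>h y > 0\<close>, this remainder equals
\<open>z\<^sup>2 / (2 * T)\<close> except within distance \<open>\<bar>z\<bar>\<close> of the two corners \<open>0\<close> and \<open>T\<close>, where it is no larger,
and it vanishes to the right of \<open>T + \<bar>z\<bar>\<close>.
As \<open>\<nu>\<close> gives mass equivalent to \<open>T\<close> to \<open>[0, T]\<close>, the effect tends to
\<open>z\<^sup>2 / 2\<close> (\<open>ramp_remainder_integral_tendsto\<close>). Dominated convergence over the law of \<open>z\<close> concludes.

Averaging over \<open>x\<close> is what makes the first-order asymptotics of \<open>\<nu> {..x}\<close> sufficient: a single
kink at \<open>x\<close> would see the increments of \<open>\<nu> {..x}\<close> at bounded scale, whereas the averaged corner has
width \<open>T\<close>. Working throughout with nonnegative integrands avoids any prior integrability of \<open>\<nu>\<close> near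
\<open>-\<infinity>\<close>.
\<close>

section \<open>The averaged ramp and its Taylor remainder\<close>

definition ramp :: "real \<Rightarrow> real \<Rightarrow> real" where
  "ramp T w = (if w \<le> 0 then T / 2 - w else if w \<le> T then (T - w)\<^sup>2 / (2 * T) else 0)"

text \<open>The slope of \<open>ramp T\<close> at \<open>w\<close> is written in the form that it has for \<open>w > 0\<close>; only such points
occur, because \<open>h\<close> takes positive values.\<close>

definition ramp_remainder :: "real \<Rightarrow> real \<Rightarrow> real \<Rightarrow> real" where
  "ramp_remainder T w z = ramp T (w + z) - ramp T w + z * (max (T - w) 0 / T)"

lemma ramp_measurable [measurable]: "ramp T \<in> borel_measurable borel"
  unfolding ramp_def[abs_def] by measurable

lemma ramp_remainder_measurable [measurable]:
  assumes [measurable]: "f \<in> borel_measurable M" "g \<in> borel_measurable M"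
  shows "(\<lambda>x. ramp_remainder T (f x) (g x)) \<in> borel_measurable M"
  unfolding ramp_remainder_def by measurable

lemma ramp_nonneg: "T > 0 \<Longrightarrow> 0 \<le> ramp T w"
  by (auto simp: ramp_def)

text \<open>This is the mean over \<open>x \<in> [0, T]\<close> of the positive part of \<open>x - w\<close>, integrated out.\<close>

lemma ramp_alt:
  assumes "T > 0"
  shows "ramp T w = ((max (T - w) 0)\<^sup>2 - (max (- w) 0)\<^sup>2) / (2 * T)"
  using assms by (auto simp: ramp_def max_def field_simps power2_eq_square)

lemma ramp_lipschitz:
  assumes "T > 0" "v \<le> w"
  shows "0 \<le> ramp T v - ramp T w" "ramp T v - ramp T w \<le> w - v"
proof -
  \<comment> \<open>between \<open>0\<close> and \<open>T\<close> the function is a parabola\<close>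
  have par: "0 \<le> (T - a)\<^sup>2 / (2 * T) - (T - b)\<^sup>2 / (2 * T)
      \<and> (T - a)\<^sup>2 / (2 * T) - (T - b)\<^sup>2 / (2 * T) \<le> b - a"
    if "0 \<le> a" "a \<le> b" "b \<le> T" for a b
  proof -
    have eq: "(T - a)\<^sup>2 / (2 * T) - (T - b)\<^sup>2 / (2 * T) = (b - a) * ((2 * T - a - b) / (2 * T))"
      using assms by (simp add: field_simps power2_eq_square)
    have "0 \<le> (2 * T - a - b) / (2 * T)" "(2 * T - a - b) / (2 * T) \<le> 1"
      using that assms by (auto simp: field_simps)
    then show ?thesis unfolding eq using that
      by (auto intro!: mult_left_le mult_nonneg_nonneg simp del: times_divide_eq_right)
  qed
  \<comment> \<open>the parabola on the clamped argument plus the linear branch; the clamp and the linear branch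
    together move by at most \<open>w - v\<close>\<close>
  have cl: "ramp T u = (T - min (max u 0) T)\<^sup>2 / (2 * T) + max (- u) 0" for u
    using assms by (auto simp: ramp_def max_def min_def power2_eq_square)
  have lin: "0 \<le> min (max v 0) T" "min (max v 0) T \<le> min (max w 0) T" "min (max w 0) T \<le> T"
      "max (- w) 0 \<le> max (- v) 0"
      "(min (max w 0) T - min (max v 0) T) + (max (- v) 0 - max (- w) 0) \<le> w - v"
    using assms by auto
  show "0 \<le> ramp T v - ramp T w" "ramp T v - ramp T w \<le> w - v"
    using par[of "min (max v 0) T" "min (max w 0) T"] lin unfolding cl by linarith+
qed

lemma ramp_remainder_eq:
  assumes "T > 0" "\<bar>z\<bar> \<le> w" "w \<le> T - \<bar>z\<bar>"
  shows "ramp_remainder T w z = z\<^sup>2 / (2 * T)"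
proof -
  have "0 \<le> w + z" "w + z \<le> T" "0 \<le> w" "w \<le> T" using assms by auto
  then show ?thesis using assms(1)
    by (auto simp: ramp_remainder_def ramp_alt max_def field_simps power2_eq_square)
qed

lemma ramp_remainder_eq_0:
  assumes "T > 0" "w > T + \<bar>z\<bar>"
  shows "ramp_remainder T w z = 0"
  using assms by (auto simp: ramp_remainder_def ramp_def)

text \<open>The remainder inherits its sign from convexity and its upper bound from the curvature being at
most \<open>1 / T\<close>. When \<open>w \<le> T\<close>, the deficit with respect to \<open>z\<^sup>2 / (2 * T)\<close> is quadratic in the
distance by which \<open>w + z\<close> leaves \<open>[0, T]\<close>.\<close>

lemma ramp_remainder_bounds:
  assumes "T > 0" "w > 0"
  shows "0 \<le> ramp_remainder T w z" "ramp_remainder T w z \<le> z\<^sup>2 / (2 * T)"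
proof -
  define v where "v = w + z"
  define D where "D = 2 * T * ramp_remainder T w z"
  have D: "D = (max (T - v) 0)\<^sup>2 - (max (- v) 0)\<^sup>2 - (max (T - w) 0)\<^sup>2 + 2 * z * max (T - w) 0"
    using assms unfolding D_def ramp_remainder_def ramp_alt[OF assms(1)] v_def[symmetric]
    by (simp add: field_simps max_def power2_eq_square)
  have "0 \<le> D \<and> D \<le> z\<^sup>2"
  proof (cases "w \<le> T")
    case True
    have sq: "D = z\<^sup>2 - (if v > T then (v - T)\<^sup>2 else if v < 0 then v\<^sup>2 else 0)"
      using True assms unfolding D v_def
      by (auto simp: max_def power2_eq_square algebra_simps)
    have "v > T \<Longrightarrow> (v - T)\<^sup>2 \<le> z\<^sup>2" "v < 0 \<Longrightarrow> v\<^sup>2 \<le> z\<^sup>2"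
      using True assms by (auto intro!: power2_le_iff_abs_le[THEN iffD2] simp: v_def abs_le_square_iff[symmetric])
    then show ?thesis unfolding sq using assms by auto
  next
    case False
    then have D': "D = (max (T - v) 0)\<^sup>2 - (max (- v) 0)\<^sup>2" using D by simp
    have "(max (- v) 0)\<^sup>2 \<le> (max (T - v) 0)\<^sup>2" using assms by (intro power_mono) auto
    moreover have "(max (T - v) 0)\<^sup>2 \<le> z\<^sup>2"
      using False by (auto simp: abs_le_square_iff[symmetric] v_def)
    moreover have "0 \<le> (max (- v) 0)\<^sup>2" by simp
    ultimately show ?thesis using D' by linarith
  qed
  then show "0 \<le> ramp_remainder T w z" "ramp_remainder T w z \<le> z\<^sup>2 / (2 * T)"
    using assms by (auto simp: D_def field_simps zero_le_mult_iff)
qed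

text \<open>For \<open>\<bar>z\<bar> > T\<close> the quadratic bound is too weak: it would be multiplied by a mass of order
\<open>\<bar>z\<bar>\<close>, which would call for a third moment. The Lipschitz bound only calls for a second moment.\<close>

lemma ramp_remainder_le_linear:
  assumes "T > 0" "w > 0"
  shows "ramp_remainder T w z \<le> 2 * \<bar>z\<bar>"
proof -
  have "ramp T (w + z) - ramp T w \<le> \<bar>z\<bar>"
    using ramp_lipschitz[OF assms(1), of "w + z" w] ramp_lipschitz[OF assms(1), of w "w + z"]
    by linarith
  moreover have "0 \<le> max (T - w) 0 / T" "max (T - w) 0 / T \<le> 1"
    using assms by (auto simp: field_simps)
  then have "\<bar>z * (max (T - w) 0 / T)\<bar> \<le> \<bar>z\<bar>"
    by (simp only: abs_mult abs_of_nonneg) (intro mult_left_le, auto)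
  ultimately show ?thesis unfolding ramp_remainder_def by linarith
qed

lemma ramp_diff_tendsto:
  "(\<lambda>n. ramp (real (Suc n)) v - ramp (real (Suc n)) w) \<longlonglongrightarrow> w - v"
proof -
  \<comment> \<open>only the difference converges: both terms diverge like \<open>T / 2\<close>\<close>
  have "(\<lambda>n. ramp (real (Suc n)) u - real (Suc n) / 2) \<longlonglongrightarrow> - u" for u
  proof -
    have "\<forall>\<^sub>F n in sequentially. (max u 0)\<^sup>2 / 2 * inverse (real (Suc n)) - u
        = ramp (real (Suc n)) u - real (Suc n) / 2"
      using eventually_ge_at_top[of "nat \<lceil>u\<rceil>"]
    proof eventually_elim
      case (elim n)
      then have "u \<le> real (Suc n)" by linarith
      then have "(max u 0)\<^sup>2 / 2 * inverse t - u = ramp t u - t / 2" if "t = real (Suc n)" for t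
      proof -
        have "t > 0" "u \<le> t" using that \<open>u \<le> real (Suc n)\<close> by auto
        then show ?thesis by (auto simp: ramp_def max_def field_simps power2_eq_square)
      qed
      from this[OF refl] show ?case .
    qed
    moreover have "(\<lambda>n. (max u 0)\<^sup>2 / 2 * inverse (real (Suc n)) - u) \<longlonglongrightarrow> (max u 0)\<^sup>2 / 2 * 0 - u"
      by (intro tendsto_intros LIMSEQ_inverse_real_of_nat)
    ultimately show ?thesis by (simp only: tendsto_cong mult_zero_right diff_0)
  qed
  from tendsto_diff[OF this[of v] this[of w]] show ?thesis by simp
qed

section \<open>The drift map and moments of the noise\<close>

lemma h_bounds: "0 < h y" "y < h y" "0 \<le> y \<Longrightarrow> h y \<le> y + 1"
proof -
  have "h y = ln (exp y * (1 + exp (- y)))"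
    using ln_mult_pos[of "exp y" "1 + exp (- y)"] by (simp add: h_def add_pos_pos)
  also have "\<dots> = ln (1 + exp y)" by (simp add: algebra_simps flip: exp_add)
  finally show "0 < h y" by (simp add: add_pos_pos)
  have "1 + exp (- y) > 1" by simp
  then have "ln (1 + exp (- y)) > 0" by (rule ln_gt_zero)
  then show "y < h y" by (simp add: h_def)
  have "ln (1 + exp (- y)) \<le> exp (- y)" by (intro ln_add_one_self_le_self) simp
  then show "h y \<le> y + 1" if "0 \<le> y"
    using that exp_le_one_iff[of "- y"] unfolding h_def by linarith
qed

lemma h_measurable [measurable]: "h \<in> borel_measurable borel"
  unfolding h_def[abs_def] by measurable

lemma exp_moment_imp_powr_moment:
  fixes Z :: "'a \<Rightarrow> real"
  assumes [measurable]: "Z \<in> borel_measurable M" and "c > 0" "\<xi> > 0"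
    and int: "integrable M (\<lambda>\<omega>. exp (c * max (Z \<omega>) 0))"
  shows "integrable M (\<lambda>\<omega>. max (Z \<omega>) 0 powr \<xi>)"
proof (rule Bochner_Integration.integrable_bound)
  show "integrable M (\<lambda>\<omega>. (\<xi> / c) powr \<xi> * exp (c * max (Z \<omega>) 0))" using int by simp
  show "AE \<omega> in M. norm (max (Z \<omega>) 0 powr \<xi>) \<le> norm ((\<xi> / c) powr \<xi> * exp (c * max (Z \<omega>) 0))"
  proof (rule AE_I2)
    fix \<omega>
    define t where "t = max (Z \<omega>) 0"
    have t: "t \<ge> 0" by (simp add: t_def)
    \<comment> \<open>\<open>u \<le> exp u\<close> at \<open>u = c t / \<xi>\<close>, raised to the power \<open>\<xi>\<close>\<close>
    have "c * t / \<xi> \<le> exp (c * t / \<xi>)" using exp_ge_add_one_self[of "c * t / \<xi>"] by linarith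
    then have "(c * t / \<xi>) powr \<xi> \<le> exp (c * t / \<xi>) powr \<xi>"
      using assms t by (intro powr_mono2) auto
    also have "\<dots> = exp (c * t)" using \<open>\<xi> > 0\<close> by (simp add: powr_def)
    finally have "(\<xi> / c) powr \<xi> * (c * t / \<xi>) powr \<xi> \<le> (\<xi> / c) powr \<xi> * exp (c * t)"
      by (intro mult_left_mono) auto
    moreover have "(\<xi> / c) powr \<xi> * (c * t / \<xi>) powr \<xi> = t powr \<xi>"
      using assms t by (simp flip: powr_mult)
    ultimately show "norm (max (Z \<omega>) 0 powr \<xi>) \<le> norm ((\<xi> / c) powr \<xi> * exp (c * max (Z \<omega>) 0))"
      by (simp add: t_def)
  qed
qed measurable

section \<open>The balance identity at a finite cutoff\<close>

text \<open>The integral of \<open>ramp T\<close> may a priori be infinite, because of its growth at \<open>-\<infinity>\<close>, but the integral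
of \<open>ramp T \<circ> h\<close> is finite, because \<open>h\<close> is positive and \<open>\<nu> {..T}\<close> is finite. So the latter can be
cancelled from both sides of the invariance relation in the extended reals. The first-order term of
the expansion drops out since the noise is centred.\<close>

lemma invariant_ramp_identity:
  fixes \<zeta> \<nu> :: "real measure"
  assumes "prob_space \<zeta>" and sets_\<zeta>: "sets \<zeta> = sets borel" and sets_\<nu>: "sets \<nu> = sets borel"
    and int: "integrable \<zeta> (\<lambda>z. z)" and mean: "(\<integral>z. z \<partial>\<zeta>) = 0"
    and fin: "emeasure \<nu> {..T} < \<infinity>"
    and inv: "invariant_measure \<zeta> \<nu>" and T: "T > 0"
  shows "(\<integral>\<^sup>+y. ennreal (ramp T y - ramp T (h y)) \<partial>\<nu>)
       = (\<integral>\<^sup>+y. (\<integral>\<^sup>+z. ennreal (ramp_remainder T (h y) z) \<partial>\<zeta>) \<partial>\<nu>)"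
proof -
  interpret prob_space \<zeta> by fact
  note [measurable_cong] = sets_\<zeta> sets_\<nu>
  define S where "S = (\<integral>\<^sup>+y. ennreal (ramp T (h y)) \<partial>\<nu>)"
  have "S \<le> (\<integral>\<^sup>+y. ennreal (T / 2) * indicator {..T} y \<partial>\<nu>)"
    unfolding S_def
  proof (intro nn_integral_mono)
    fix y
    have "ramp T (h y) = 0" if "y > T"
      using h_bounds[of y] that T by (auto simp: ramp_def)
    moreover have "ramp T (h y) \<le> T / 2"
      using ramp_lipschitz(1)[OF T, of 0 "h y"] h_bounds(1)[of y] by (simp add: ramp_def)
    ultimately show "ennreal (ramp T (h y)) \<le> ennreal (T / 2) * indicator {..T} y"
      by (auto simp: indicator_def intro!: ennreal_leI)
  qed
  also have "\<dots> = ennreal (T / 2) * emeasure \<nu> {..T}"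
    by (subst nn_integral_cmult_indicator) auto
  also have "\<dots> < \<infinity>" using fin by (simp add: ennreal_mult_less_top)
  finally have S_fin: "S \<noteq> \<infinity>" by simp
  have inner: "(\<integral>\<^sup>+z. ennreal (ramp T (z + w)) \<partial>\<zeta>)
      = (\<integral>\<^sup>+z. ennreal (ramp_remainder T w z) \<partial>\<zeta>) + ennreal (ramp T w)" if "w > 0" for w
  proof -
    have i1: "integrable \<zeta> (\<lambda>z. ramp T (w + z))"
    proof (rule Bochner_Integration.integrable_bound[where f="\<lambda>z. ramp T w + \<bar>z\<bar>"])
      show "AE z in \<zeta>. norm (ramp T (w + z)) \<le> norm (ramp T w + \<bar>z\<bar>)"
      proof (rule AE_I2)
        fix z
        show "norm (ramp T (w + z)) \<le> norm (ramp T w + \<bar>z\<bar>)"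
          using ramp_lipschitz[OF T, of "w + z" w] ramp_lipschitz[OF T, of w "w + z"]
            ramp_nonneg[OF T, of w] ramp_nonneg[OF T, of "w + z"]
          unfolding real_norm_def by linarith
      qed
      show "integrable \<zeta> (\<lambda>z. ramp T w + \<bar>z\<bar>)"
        by (intro Bochner_Integration.integrable_add integrable_abs int) simp
      show "(\<lambda>z. ramp T (w + z)) \<in> borel_measurable \<zeta>" by measurable
    qed
    define m where "m = max (T - w) 0 / T"
    have rem: "ramp_remainder T w = (\<lambda>z. ramp T (w + z) - ramp T w + z * m)"
      by (simp add: ramp_remainder_def m_def fun_eq_iff)
    have i3: "integrable \<zeta> (\<lambda>z. z * m)" using int by (rule integrable_mult_left)
    have i2: "integrable \<zeta> (ramp_remainder T w)"
      unfolding rem by (intro Bochner_Integration.integrable_add Bochner_Integration.integrable_diff i1 i3) simp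
    have eq: "(\<integral>z. ramp T (w + z) \<partial>\<zeta>) = (\<integral>z. ramp_remainder T w z \<partial>\<zeta>) + ramp T w"
    proof -
      have "(\<integral>z. z * m \<partial>\<zeta>) = 0" using mean by simp
      then show ?thesis
        unfolding rem using i1 i3 by (simp add: prob_space)
    qed
    have "(\<integral>\<^sup>+z. ennreal (ramp T (z + w)) \<partial>\<zeta>) = ennreal (\<integral>z. ramp T (w + z) \<partial>\<zeta>)"
      using i1 ramp_nonneg[OF T] by (simp add: nn_integral_eq_integral add.commute)
    also have "\<dots> = ennreal (\<integral>z. ramp_remainder T w z \<partial>\<zeta>) + ennreal (ramp T w)"
      unfolding eq
      using ramp_remainder_bounds(1)[OF T that] ramp_nonneg[OF T]
      by (intro ennreal_plus Bochner_Integration.integral_nonneg) 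
    also have "ennreal (\<integral>z. ramp_remainder T w z \<partial>\<zeta>) = (\<integral>\<^sup>+z. ennreal (ramp_remainder T w z) \<partial>\<zeta>)"
      using i2 ramp_remainder_bounds(1)[OF T that] by (simp add: nn_integral_eq_integral)
    finally show ?thesis .
  qed
  have "(\<integral>\<^sup>+y. ennreal (ramp T y - ramp T (h y)) \<partial>\<nu>) + S
      = (\<integral>\<^sup>+y. ennreal (ramp T y - ramp T (h y)) + ennreal (ramp T (h y)) \<partial>\<nu>)"
    unfolding S_def by (rule nn_integral_add[symmetric]) auto
  also have "\<dots> = (\<integral>\<^sup>+y. ennreal (ramp T y) \<partial>\<nu>)"
    using ramp_lipschitz(1)[OF T less_imp_le[OF h_bounds(2)]] ramp_nonneg[OF T]
    by (intro nn_integral_cong) (simp flip: ennreal_plus)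
  also have "\<dots> = (\<integral>\<^sup>+y. (\<integral>\<^sup>+z. ennreal (ramp T (z + h y)) \<partial>\<zeta>) \<partial>\<nu>)"
    using inv[unfolded invariant_measure_def, rule_format, of "\<lambda>y. ennreal (ramp T y)"] by simp
  also have "\<dots> = (\<integral>\<^sup>+y. (\<integral>\<^sup>+z. ennreal (ramp_remainder T (h y) z) \<partial>\<zeta>) + ennreal (ramp T (h y)) \<partial>\<nu>)"
    by (intro nn_integral_cong inner h_bounds)
  also have "\<dots> = (\<integral>\<^sup>+y. (\<integral>\<^sup>+z. ennreal (ramp_remainder T (h y) z) \<partial>\<zeta>) \<partial>\<nu>) + S"
    unfolding S_def by (rule nn_integral_add) auto
  finally show ?thesis using S_fin by (simp add: ennreal_add_left_cancel add.commute[of _ S])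
qed

section \<open>The effect of a single noise value\<close>

lemma ramp_remainder_integral_le:
  fixes \<nu> :: "real measure"
  assumes sets_\<nu>: "sets \<nu> = sets borel" and fin: "\<And>x. emeasure \<nu> {..x} < \<infinity>"
    and T: "T > 0" and b: "\<And>w. w > 0 \<Longrightarrow> ramp_remainder T w z \<le> b" and b0: "b \<ge> 0"
  shows "(\<integral>\<^sup>+y. ennreal (ramp_remainder T (h y) z) \<partial>\<nu>) \<le> ennreal (b * measure \<nu> {..T + \<bar>z\<bar>})"
proof -
  note [measurable_cong] = sets_\<nu>
  have "(\<integral>\<^sup>+y. ennreal (ramp_remainder T (h y) z) \<partial>\<nu>)
      \<le> (\<integral>\<^sup>+y. ennreal b * indicator {..T + \<bar>z\<bar>} y \<partial>\<nu>)"
  proof (intro nn_integral_mono)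
    fix y
    show "ennreal (ramp_remainder T (h y) z) \<le> ennreal b * indicator {..T + \<bar>z\<bar>} y"
      using ramp_remainder_eq_0[OF T, of z "h y"] h_bounds[of y] b[of "h y"]
      by (auto simp: indicator_def intro!: ennreal_leI)
  qed
  also have "\<dots> = ennreal b * emeasure \<nu> {..T + \<bar>z\<bar>}"
    by (subst nn_integral_cmult_indicator) auto
  also have "\<dots> = ennreal (b * measure \<nu> {..T + \<bar>z\<bar>})"
    using fin[of "T + \<bar>z\<bar>"] b0 by (simp add: emeasure_eq_ennreal_measure ennreal_mult)
  finally show ?thesis .
qed

text \<open>If \<open>\<bar>z\<bar> < y \<le> T - \<bar>z\<bar> - 1\<close>, then \<open>h y\<close> lies in the region where the remainder is exactly
\<open>z\<^sup>2 / (2 * T)\<close>; the extra \<open>1\<close> absorbs \<open>h y - y \<le> 1\<close>.\<close>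

lemma ramp_remainder_integral_ge:
  fixes \<nu> :: "real measure"
  assumes sets_\<nu>: "sets \<nu> = sets borel" and fin: "\<And>x. emeasure \<nu> {..x} < \<infinity>"
    and T: "T \<ge> 2 * \<bar>z\<bar> + 1"
  shows "ennreal (z\<^sup>2 / (2 * T) * (measure \<nu> {..T - (\<bar>z\<bar> + 1)} - measure \<nu> {..\<bar>z\<bar>}))
      \<le> (\<integral>\<^sup>+y. ennreal (ramp_remainder T (h y) z) \<partial>\<nu>)"
proof -
  note [measurable_cong] = sets_\<nu>
  define A where "A = {..T - (\<bar>z\<bar> + 1)} - {..\<bar>z\<bar>}"
  have T0: "T > 0" using T by linarith
  have A_sets [measurable]: "A \<in> sets borel" by (simp add: A_def)
  have A_fin: "emeasure \<nu> A \<noteq> \<infinity>"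
    using emeasure_mono[of A "{..T - (\<bar>z\<bar> + 1)}" \<nu>] fin[of "T - (\<bar>z\<bar> + 1)"]
    by (auto simp: A_def sets_\<nu> top_unique)
  have "measure \<nu> A = measure \<nu> {..T - (\<bar>z\<bar> + 1)} - measure \<nu> {..\<bar>z\<bar>}"
    unfolding A_def using T fin by (intro measure_Diff) (auto simp: sets_\<nu> less_top)
  then have "ennreal (z\<^sup>2 / (2 * T) * (measure \<nu> {..T - (\<bar>z\<bar> + 1)} - measure \<nu> {..\<bar>z\<bar>}))
      = ennreal (z\<^sup>2 / (2 * T)) * emeasure \<nu> A"
    using A_fin T0 emeasure_eq_ennreal_measure[of \<nu> A]
    by (simp add: ennreal_mult del: times_divide_eq_left flip: \<open>measure \<nu> A = _\<close>)
  also have "\<dots> = (\<integral>\<^sup>+y. ennreal (z\<^sup>2 / (2 * T)) * indicator A y \<partial>\<nu>)"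
    by (subst nn_integral_cmult_indicator) auto
  also have "\<dots> \<le> (\<integral>\<^sup>+y. ennreal (ramp_remainder T (h y) z) \<partial>\<nu>)"
  proof (intro nn_integral_mono)
    fix y
    show "ennreal (z\<^sup>2 / (2 * T)) * indicator A y \<le> ennreal (ramp_remainder T (h y) z)"
    proof (cases "y \<in> A")
      case True
      then have "\<bar>z\<bar> \<le> h y" "h y \<le> T - \<bar>z\<bar>"
        using h_bounds(2)[of y] h_bounds(3)[of y] unfolding A_def by (auto, linarith+)
      then show ?thesis using ramp_remainder_eq[OF T0] by (simp add: indicator_def)
    qed simp
  qed
  finally show ?thesis .
qed

lemma ramp_remainder_integral_tendsto:
  fixes \<nu> :: "real measure"
  assumes sets_\<nu>: "sets \<nu> = sets borel" and fin: "\<And>x. emeasure \<nu> {..x} < \<infinity>"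
    and lim: "((\<lambda>x. measure \<nu> {..x} / x) \<longlongrightarrow> 1) at_top"
  shows "((\<lambda>T. \<integral>\<^sup>+y. ennreal (ramp_remainder T (h y) z) \<partial>\<nu>) \<longlongrightarrow> ennreal (z\<^sup>2 / 2)) at_top"
proof -
  have shift: "((\<lambda>T. measure \<nu> {..T + a} / T) \<longlongrightarrow> 1) at_top" for a
  proof -
    have *: "filterlim (\<lambda>T::real. T + a) at_top at_top"
      using filterlim_tendsto_add_at_top[OF tendsto_const filterlim_ident, of a] by (simp add: add.commute)
    have r: "((\<lambda>T::real. 1 + a / T) \<longlongrightarrow> 1 + 0) at_top"
      by (intro tendsto_intros real_tendsto_divide_at_top[OF tendsto_const] filterlim_ident)
    have "((\<lambda>T. measure \<nu> {..T + a} / (T + a) * (1 + a / T)) \<longlongrightarrow> 1 * (1 + 0)) at_top"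
      by (rule tendsto_mult[OF filterlim_compose[OF lim *] r])
    moreover have "\<forall>\<^sub>F T in at_top. measure \<nu> {..T + a} / (T + a) * (1 + a / T) = measure \<nu> {..T + a} / T"
      using eventually_gt_at_top[of "max 0 (- a)"]
    proof eventually_elim
      case (elim T)
      then have "1 + a / T = (T + a) / T" "T + a \<noteq> 0" by (auto simp: field_simps)
      then show ?case by (metis times_divide_times_eq nonzero_mult_divide_mult_cancel_left mult.commute)
    qed
    ultimately show ?thesis by (simp add: tendsto_cong)
  qed
  show ?thesis
  proof (rule tendsto_sandwich)
    show "\<forall>\<^sub>F T in at_top. ennreal (z\<^sup>2 / (2 * T) * (measure \<nu> {..T - (\<bar>z\<bar> + 1)} - measure \<nu> {..\<bar>z\<bar>}))
        \<le> (\<integral>\<^sup>+y. ennreal (ramp_remainder T (h y) z) \<partial>\<nu>)"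
      using eventually_ge_at_top[of "2 * \<bar>z\<bar> + 1"]
      by eventually_elim (rule ramp_remainder_integral_ge[OF sets_\<nu> fin])
    show "\<forall>\<^sub>F T in at_top. (\<integral>\<^sup>+y. ennreal (ramp_remainder T (h y) z) \<partial>\<nu>)
        \<le> ennreal (z\<^sup>2 / (2 * T) * measure \<nu> {..T + \<bar>z\<bar>})"
      using eventually_gt_at_top[of 0]
    proof eventually_elim
      case (elim T)
      then show ?case
        by (intro ramp_remainder_integral_le[OF sets_\<nu> fin] ramp_remainder_bounds(2)) auto
    qed
    have "((\<lambda>T. z\<^sup>2 / 2 * (measure \<nu> {..T + \<bar>z\<bar>} / T)) \<longlongrightarrow> z\<^sup>2 / 2 * 1) at_top"
      by (intro tendsto_intros shift)
    then show "((\<lambda>T. ennreal (z\<^sup>2 / (2 * T) * measure \<nu> {..T + \<bar>z\<bar>})) \<longlongrightarrow> ennreal (z\<^sup>2 / 2)) at_top"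
      by (intro tendsto_ennrealI) simp
    have "((\<lambda>T. z\<^sup>2 / 2 * (measure \<nu> {..T + - (\<bar>z\<bar> + 1)} / T - measure \<nu> {..\<bar>z\<bar>} / T))
        \<longlongrightarrow> z\<^sup>2 / 2 * (1 - 0)) at_top"
      by (intro tendsto_intros shift real_tendsto_divide_at_top[OF tendsto_const] filterlim_ident)
    then show "((\<lambda>T. ennreal (z\<^sup>2 / (2 * T) * (measure \<nu> {..T - (\<bar>z\<bar> + 1)} - measure \<nu> {..\<bar>z\<bar>})))
        \<longlongrightarrow> ennreal (z\<^sup>2 / 2)) at_top"
      by (intro tendsto_ennrealI) (simp add: diff_divide_distrib algebra_simps)
  qed
qed

section \<open>Passing to the limit\<close>

lemma linear_growth_bound:
  fixes N :: "real \<Rightarrow> real"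
  assumes lim: "((\<lambda>x. N x / x) \<longlongrightarrow> 1) at_top" and mono: "mono N"
  obtains C where "C > 0" "\<And>x. x \<ge> 1 \<Longrightarrow> N x \<le> C * x"
proof -
  have "\<forall>\<^sub>F x in at_top. N x / x < 2 \<and> x \<ge> 1"
    using order_tendstoD(2)[OF lim, of 2] eventually_ge_at_top[of 1] by (auto intro: eventually_conj)
  then obtain x0 where x0: "\<And>x. x \<ge> x0 \<Longrightarrow> N x / x < 2 \<and> x \<ge> 1"
    unfolding eventually_at_top_linorder by blast
  have "N x \<le> 2 * x0 * x" if "x \<ge> 1" for x
  proof (cases "x \<ge> x0")
    case True
    then have "N x < 2 * x" using x0[of x] by (auto simp: field_simps)
    also have "\<dots> \<le> 2 * x0 * x" using x0[of x0] that by simp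
    finally show ?thesis by simp
  next
    case False
    then have "N x \<le> N x0" using mono by (simp add: monoD)
    also have "\<dots> \<le> 2 * x0" using x0[of x0] by (auto simp: field_simps)
    also have "\<dots> \<le> 2 * x0 * x" using x0[of x0] that by simp
    finally show ?thesis .
  qed
  then show thesis using x0[of x0] by (intro that[of "2 * x0"]) auto
qed

text \<open>Fatou's lemma and the Lipschitz bound squeeze the effect of the push; for the effect of the noise,
a multiple of \<open>z\<^sup>2\<close> dominates uniformly in the cutoff.\<close>

lemma invariant_measure_drift_integral:
  fixes \<zeta> \<nu> :: "real measure"
  assumes "prob_space \<zeta>" and sets_\<zeta>: "sets \<zeta> = sets borel" and sets_\<nu>: "sets \<nu> = sets borel"
    and int: "integrable \<zeta> (\<lambda>z. z)" and mean: "(\<integral>z. z \<partial>\<zeta>) = 0"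
    and int2: "integrable \<zeta> (\<lambda>z. z\<^sup>2)"
    and fin: "\<And>x. emeasure \<nu> {..x} < \<infinity>"
    and lim: "((\<lambda>x. measure \<nu> {..x} / x) \<longlongrightarrow> 1) at_top"
    and inv: "invariant_measure \<zeta> \<nu>"
  shows "(\<integral>\<^sup>+y. ennreal (h y - y) \<partial>\<nu>) = ennreal ((\<integral>z. z\<^sup>2 \<partial>\<zeta>) / 2)"
proof -
  interpret \<zeta>: prob_space \<zeta> by fact
  note [measurable_cong] = sets_\<zeta> sets_\<nu>
  have "sigma_finite_measure \<nu>"
  proof
    show "\<exists>A. countable A \<and> A \<subseteq> sets \<nu> \<and> \<Union> A = space \<nu> \<and> (\<forall>a\<in>A. emeasure \<nu> a \<noteq> \<infinity>)"
    proof (intro exI conjI)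
      show "\<Union> (range (\<lambda>n. {..real n})) = space \<nu>"
        using sets_eq_imp_space_eq[OF sets_\<nu>] real_arch_simple by auto
      show "\<forall>a\<in>range (\<lambda>n. {..real n}). emeasure \<nu> a \<noteq> \<infinity>"
        using fin by (auto simp: less_top)
    qed (auto simp: sets_\<nu>)
  qed
  then interpret P: pair_sigma_finite \<zeta> \<nu>
    by (simp add: pair_sigma_finite_def \<zeta>.sigma_finite_measure_axioms)
  define q where "q T z = (\<integral>\<^sup>+y. ennreal (ramp_remainder T (h y) z) \<partial>\<nu>)" for T z
  define d where "d T = (\<integral>\<^sup>+y. ennreal (ramp T y - ramp T (h y)) \<partial>\<nu>)" for T
  have q_meas [measurable]: "q T \<in> borel_measurable \<zeta>" for T
    unfolding q_def[abs_def] by measurable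
  have d_eq: "d T = (\<integral>\<^sup>+z. q T z \<partial>\<zeta>)" if "T > 0" for T
    unfolding d_def q_def
    by (subst invariant_ramp_identity[OF \<open>prob_space \<zeta>\<close> sets_\<zeta> sets_\<nu> int mean fin inv that],
        rule P.Fubini', measurable)
  obtain C where C: "C > 0" "\<And>x. x \<ge> 1 \<Longrightarrow> measure \<nu> {..x} \<le> C * x"
  proof (rule linear_growth_bound[OF lim])
    show "mono (\<lambda>x. measure \<nu> {..x})"
      using fin by (intro monoI measure_mono_fmeasurable) (auto simp: fmeasurable_def sets_\<nu>)
  qed blast
  \<comment> \<open>mass at most \<open>C * (T + \<bar>z\<bar>)\<close> times the better of the quadratic and the linear bound\<close>
  have q_le: "q T z \<le> ennreal (4 * C * z\<^sup>2)" if "T \<ge> 1" for T z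
  proof (cases "\<bar>z\<bar> \<le> T")
    case True
    have "q T z \<le> ennreal (z\<^sup>2 / (2 * T) * measure \<nu> {..T + \<bar>z\<bar>})"
      unfolding q_def using that
      by (intro ramp_remainder_integral_le[OF sets_\<nu> fin] ramp_remainder_bounds(2)) auto
    also have "z\<^sup>2 / (2 * T) * measure \<nu> {..T + \<bar>z\<bar>} \<le> z\<^sup>2 / (2 * T) * (C * (2 * T))"
    proof (intro mult_left_mono)
      have "measure \<nu> {..T + \<bar>z\<bar>} \<le> C * (T + \<bar>z\<bar>)" using that by (intro C) auto
      also have "\<dots> \<le> C * (2 * T)" using True C(1) by (intro mult_left_mono) auto
      finally show "measure \<nu> {..T + \<bar>z\<bar>} \<le> C * (2 * T)" .
    qed (use that in auto)
    also have "\<dots> \<le> 4 * C * z\<^sup>2" using that C(1) by (simp add: field_simps)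
    finally show ?thesis by (simp add: ennreal_leI)
  next
    case False
    have "q T z \<le> ennreal (2 * \<bar>z\<bar> * measure \<nu> {..T + \<bar>z\<bar>})"
      unfolding q_def using that
      by (intro ramp_remainder_integral_le[OF sets_\<nu> fin] ramp_remainder_le_linear) auto
    also have "2 * \<bar>z\<bar> * measure \<nu> {..T + \<bar>z\<bar>} \<le> 2 * \<bar>z\<bar> * (C * (2 * \<bar>z\<bar>))"
    proof (intro mult_left_mono)
      have "measure \<nu> {..T + \<bar>z\<bar>} \<le> C * (T + \<bar>z\<bar>)" using that by (intro C) auto
      also have "\<dots> \<le> C * (2 * \<bar>z\<bar>)" using False C(1) by (intro mult_left_mono) auto
      finally show "measure \<nu> {..T + \<bar>z\<bar>} \<le> C * (2 * \<bar>z\<bar>)" .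
    qed auto
    also have "\<dots> = 4 * C * z\<^sup>2" by (simp add: power2_eq_square)
    finally show ?thesis by (simp add: ennreal_leI)
  qed
  have Suc_lim: "filterlim (\<lambda>n. real (Suc n)) at_top sequentially"
    using filterlim_real_sequentially filterlim_Suc by (rule filterlim_compose)
  have "(\<lambda>n. \<integral>\<^sup>+z. q (real (Suc n)) z \<partial>\<zeta>) \<longlonglongrightarrow> (\<integral>\<^sup>+z. ennreal (z\<^sup>2 / 2) \<partial>\<zeta>)"
  proof (rule nn_integral_dominated_convergence[where w="\<lambda>z. ennreal (4 * C * z\<^sup>2)"])
    show "(\<integral>\<^sup>+z. ennreal (4 * C * z\<^sup>2) \<partial>\<zeta>) < \<infinity>"
      using int2 C(1) by (subst nn_integral_eq_integral) auto
    show "AE z in \<zeta>. (\<lambda>n. q (real (Suc n)) z) \<longlonglongrightarrow> ennreal (z\<^sup>2 / 2)"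
      unfolding q_def
      by (intro AE_I2 filterlim_compose[OF ramp_remainder_integral_tendsto[OF sets_\<nu> fin lim] Suc_lim])
  qed (use q_le in auto)
  moreover have "(\<integral>\<^sup>+z. ennreal (z\<^sup>2 / 2) \<partial>\<zeta>) = ennreal ((\<integral>z. z\<^sup>2 \<partial>\<zeta>) / 2)"
    using int2 by (subst nn_integral_eq_integral) auto
  ultimately have d_lim: "(\<lambda>n. d (real (Suc n))) \<longlonglongrightarrow> ennreal ((\<integral>z. z\<^sup>2 \<partial>\<zeta>) / 2)"
    by (simp add: d_eq)
  show ?thesis
  proof (rule antisym)
    have "(\<integral>\<^sup>+y. ennreal (h y - y) \<partial>\<nu>)
        = (\<integral>\<^sup>+y. liminf (\<lambda>n. ennreal (ramp (real (Suc n)) y - ramp (real (Suc n)) (h y))) \<partial>\<nu>)"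
      by (intro nn_integral_cong lim_imp_Liminf[symmetric] tendsto_ennrealI ramp_diff_tendsto) simp
    also have "\<dots> \<le> liminf (\<lambda>n. d (real (Suc n)))"
      unfolding d_def by (rule nn_integral_liminf) simp
    also have "\<dots> = ennreal ((\<integral>z. z\<^sup>2 \<partial>\<zeta>) / 2)"
      by (rule lim_imp_Liminf[OF _ d_lim]) simp
    finally show "(\<integral>\<^sup>+y. ennreal (h y - y) \<partial>\<nu>) \<le> ennreal ((\<integral>z. z\<^sup>2 \<partial>\<zeta>) / 2)" .
    show "ennreal ((\<integral>z. z\<^sup>2 \<partial>\<zeta>) / 2) \<le> (\<integral>\<^sup>+y. ennreal (h y - y) \<partial>\<nu>)"
    proof (rule LIMSEQ_le_const2[OF d_lim], intro exI allI impI)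
      fix n
      show "d (real (Suc n)) \<le> (\<integral>\<^sup>+y. ennreal (h y - y) \<partial>\<nu>)"
        unfolding d_def
        by (intro nn_integral_mono ennreal_leI ramp_lipschitz(2) less_imp_le[OF h_bounds(2)]) simp
    qed
  qed
qed

theorem propositionA1:
  fixes M :: "'a measure" and Z :: "'a \<Rightarrow> real" and \<zeta> \<nu> :: "real measure" and n\<^sub>0 :: nat
  assumes "prob_space M"
    and "Z \<in> borel_measurable M"
    and "\<zeta> = distr M borel Z"
    and "integrable M Z"
    and "(\<integral>\<omega>. Z \<omega> \<partial>M) = 0"
    and "integrable M (\<lambda>\<omega>. (Z \<omega>)\<^sup>2)"
    and "(\<integral>\<omega>. (Z \<omega>)\<^sup>2 \<partial>M) > 0"
    and "n\<^sub>0 \<ge> 1"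
    and "has_lebesgue_density (conv_power \<zeta> n\<^sub>0)"
  shows "((\<exists>c>0. integrable M (\<lambda>\<omega>. exp (c * max (Z \<omega>) 0))) \<longrightarrow>
            (\<exists>\<xi>>4. integrable M (\<lambda>\<omega>. max (Z \<omega>) 0 powr \<xi>)))
       \<and> ((\<exists>\<xi>>4. integrable M (\<lambda>\<omega>. max (Z \<omega>) 0 powr \<xi>)) \<longrightarrow>
            radon_measure \<nu> \<longrightarrow> invariant_measure \<zeta> \<nu> \<longrightarrow>
            (\<lambda>x. measure \<nu> {..x}) \<sim>[at_top] (\<lambda>x. x) \<longrightarrow>
            (\<integral>\<^sup>+x. ennreal (ln (1 + exp (- x))) \<partial>\<nu>) = ennreal ((\<integral>\<omega>. (Z \<omega>)\<^sup>2 \<partial>M) / 2))"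
proof (intro conjI impI)
  assume "\<exists>c>0. integrable M (\<lambda>\<omega>. exp (c * max (Z \<omega>) 0))"
  then have "integrable M (\<lambda>\<omega>. max (Z \<omega>) 0 powr 5)"
    using assms(2) exp_moment_imp_powr_moment[where \<xi> = 5] by auto
  then show "\<exists>\<xi>>4. integrable M (\<lambda>\<omega>. max (Z \<omega>) 0 powr \<xi>)"
    by (intro exI[of _ 5]) simp
next
  assume radon: "radon_measure \<nu>" and inv: "invariant_measure \<zeta> \<nu>"
    and asymp: "(\<lambda>x. measure \<nu> {..x}) \<sim>[at_top] (\<lambda>x. x)"
  note [measurable] = assms(2)
  have sets_\<nu>: "sets \<nu> = sets borel" using radon by (simp add: radon_measure_def)
  have lim: "((\<lambda>x. measure \<nu> {..x} / x) \<longlongrightarrow> 1) at_top"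
    using asymp by (rule asymp_equivD_strong) (auto intro: eventually_mono[OF eventually_gt_at_top[of 0]])
  \<comment> \<open>\<open>measure\<close> is \<open>0\<close> on sets of infinite mass, so a positive value certifies finiteness\<close>
  have fin: "emeasure \<nu> {..x} < \<infinity>" for x
  proof -
    have "\<forall>\<^sub>F t in at_top. measure \<nu> {..t} / t > 0 \<and> t \<ge> x"
      using order_tendstoD(1)[OF lim, of 0] eventually_ge_at_top[of x] by (auto intro: eventually_conj)
    then obtain t where t: "measure \<nu> {..t} / t > 0" "t \<ge> x"
      by (metis (mono_tags, lifting) eventually_happens trivial_limit_at_top_linorder)
    then have "emeasure \<nu> {..t} < \<infinity>"
      by (cases "emeasure \<nu> {..t} = \<infinity>") (auto simp: measure_def less_top)
    then show ?thesis
      using t(2) emeasure_mono[of "{..x}" "{..t}" \<nu>] by (auto simp: sets_\<nu> intro: le_less_trans)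
  qed
  have "(\<integral>\<^sup>+y. ennreal (h y - y) \<partial>\<nu>) = ennreal ((\<integral>z. z\<^sup>2 \<partial>\<zeta>) / 2)"
  proof (rule invariant_measure_drift_integral[OF _ _ sets_\<nu> _ _ _ fin lim inv])
    show "prob_space \<zeta>" unfolding assms(3) using assms(1,2) by (rule prob_space.prob_space_distr)
    show "integrable \<zeta> (\<lambda>z. z)" "(\<integral>z. z \<partial>\<zeta>) = 0" "integrable \<zeta> (\<lambda>z. z\<^sup>2)"
      using assms(4,5,6) by (simp_all add: assms(3) integrable_distr_eq integral_distr)
  qed (simp add: assms(3))
  also have "(\<integral>z. z\<^sup>2 \<partial>\<zeta>) = (\<integral>\<omega>. (Z \<omega>)\<^sup>2 \<partial>M)"
    by (simp add: assms(3) integral_distr)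
  finally show "(\<integral>\<^sup>+x. ennreal (ln (1 + exp (- x))) \<partial>\<nu>) = ennreal ((\<integral>\<omega>. (Z \<omega>)\<^sup>2 \<partial>M) / 2)"
    by (simp add: h_def)
qed

end
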